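(* An infinite direct product of strongly $\pi$-regular rings (in particular, of $\pi$-regular rings) need not be D-regularly nil clean, and an infinite direct product of D-regularly nil clean rings need not be D-regularly nil clean. Specifically, each ring $\mathbb{Z}/2^k\mathbb{Z}$ ($k\geq 1$) is strongly $\pi$-regular and D-regularly nil clean, but the direct product $R=\prod_{k\geq 1}\mathbb{Z}/2^k\mathbb{Z}$ is not D-regularly nil clean.
   Context: All rings are associative with identity. A ring $R$ is called $\pi$-regular if for every $r\in R$ there exists a positive integer $n$ with $r^n\in r^nRr^n$, and strongly $\pi$-regular if for every $r\in R$ there exists a positive integer $n$ with $r^n\in r^{n+1}R\cap Rr^{n+1}$. A ring $R$ is called D-regularly nil clean if for every $a\in R$ there exists an idempotent $e\in aRa$ such that $a(1-e)$ is nilpotent. *)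

theory Defs
  imports "HOL-Algebra.Product_Groups" "HOL-Number_Theory.Residues"
begin

text \<open>
  The predicates below are meant for structures satisfying \<^locale>\<open>ring\<close> (associative, with
  identity, not necessarily commutative). They do not include that hypothesis, so that their
  negations cannot hold merely because the structure fails to be a ring.
\<close>

definition pi_regular :: "('a, 'm) ring_scheme \<Rightarrow> bool" where
  "pi_regular R \<longleftrightarrow>
     (\<forall>r\<in>carrier R. \<exists>n::nat. n > 0 \<and>
        r [^]\<^bsub>R\<^esub> n \<in> {r [^]\<^bsub>R\<^esub> n \<otimes>\<^bsub>R\<^esub> x \<otimes>\<^bsub>R\<^esub> r [^]\<^bsub>R\<^esub> n | x. x \<in> carrier R})"

definition strongly_pi_regular :: "('a, 'm) ring_scheme \<Rightarrow> bool" where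
  "strongly_pi_regular R \<longleftrightarrow>
     (\<forall>r\<in>carrier R. \<exists>n::nat. n > 0 \<and>
        r [^]\<^bsub>R\<^esub> n \<in> {r [^]\<^bsub>R\<^esub> (n + 1) \<otimes>\<^bsub>R\<^esub> x | x. x \<in> carrier R}
                  \<inter> {x \<otimes>\<^bsub>R\<^esub> r [^]\<^bsub>R\<^esub> (n + 1) | x. x \<in> carrier R})"

definition idempotent_elem :: "('a, 'm) ring_scheme \<Rightarrow> 'a \<Rightarrow> bool" where
  "idempotent_elem R e \<longleftrightarrow> e \<in> carrier R \<and> e \<otimes>\<^bsub>R\<^esub> e = e"

definition nilpotent_elem :: "('a, 'm) ring_scheme \<Rightarrow> 'a \<Rightarrow> bool" where
  "nilpotent_elem R a \<longleftrightarrow> a \<in> carrier R \<and> (\<exists>n::nat. n > 0 \<and> a [^]\<^bsub>R\<^esub> n = \<zero>\<^bsub>R\<^esub>)"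

definition D_regularly_nil_clean :: "('a, 'm) ring_scheme \<Rightarrow> bool" where
  "D_regularly_nil_clean R \<longleftrightarrow>
     (\<forall>a\<in>carrier R. \<exists>e\<in>{a \<otimes>\<^bsub>R\<^esub> x \<otimes>\<^bsub>R\<^esub> a | x. x \<in> carrier R}.
        idempotent_elem R e \<and> nilpotent_elem R (a \<otimes>\<^bsub>R\<^esub> (\<one>\<^bsub>R\<^esub> \<ominus>\<^bsub>R\<^esub> e)))"

text \<open>Ring analogue of \<^const>\<open>product_group\<close>: extensional functions, componentwise operations.\<close>

definition product_ring :: "'i set \<Rightarrow> ('i \<Rightarrow> ('a, 'm) ring_scheme) \<Rightarrow> ('i \<Rightarrow> 'a) ring" where
  "product_ring I R =
     \<lparr>carrier = (\<Pi>\<^sub>E i\<in>I. carrier (R i)),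
      monoid.mult = (\<lambda>x y. \<lambda>i\<in>I. x i \<otimes>\<^bsub>R i\<^esub> y i),
      one = (\<lambda>i\<in>I. \<one>\<^bsub>R i\<^esub>),
      zero = (\<lambda>i\<in>I. \<zero>\<^bsub>R i\<^esub>),
      add = (\<lambda>x y. \<lambda>i\<in>I. x i \<oplus>\<^bsub>R i\<^esub> y i)\<rparr>"

end

theory Submission
  imports Defs
begin

text \<open>
  Every element of \<open>\<int>/2\<^sup>k\<close> is a unit or nilpotent, which makes the factors strongly
  \<open>\<pi>\<close>-regular and D-regularly nil clean. In the product take \<open>a = (2, 2, 2, \<dots>)\<close>. All
  components of \<open>a\<close> are nilpotent, so an idempotent of the form \<open>a x a\<close> is nilpotent in every
  component and hence zero. D-regular nil cleanness would then force \<open>a\<close> itself to be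
  nilpotent, but the nilpotency indices of its components are unbounded.
\<close>

section \<open>Regularity and nil cleanness in a single ring\<close>

lemma (in ring) unit_or_nilpotent_imp_strongly_pi_regular:
  assumes "\<And>r. r \<in> carrier R \<Longrightarrow> r \<in> Units R \<or> nilpotent_elem R r"
  shows "strongly_pi_regular R"
  unfolding strongly_pi_regular_def
proof
  fix r assume r: "r \<in> carrier R"
  from assms[OF r] show "\<exists>n::nat. n > 0 \<and>
        r [^] n \<in> {r [^] (n + 1) \<otimes> x | x. x \<in> carrier R}
                  \<inter> {x \<otimes> r [^] (n + 1) | x. x \<in> carrier R}"
  proof
    assume u: "r \<in> Units R"
    \<comment> \<open>For a unit the exponent 1 suffices, with \<open>inv r\<close> as cofactor on
      both sides.\<close>
    then have "r = r \<otimes> r \<otimes> inv r" "r = inv r \<otimes> (r \<otimes> r)"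
      using r by (simp_all add: m_assoc m_assoc[symmetric, of "inv r"])
    then have "r [^] (1::nat) \<in> {r [^] (1 + 1 :: nat) \<otimes> x | x. x \<in> carrier R}
                  \<inter> {x \<otimes> r [^] (1 + 1 :: nat) | x. x \<in> carrier R}"
      using u r by auto
    then show ?thesis by blast
  next
    assume "nilpotent_elem R r"
    then obtain n :: nat where n: "n > 0" "r [^] n = \<zero>"
      by (auto simp: nilpotent_elem_def)
    \<comment> \<open>Since \<open>r [^] n\<close> vanishes, \<open>\<zero>\<close> serves as
      cofactor on both sides.\<close>
    have "r [^] n = r [^] (n + 1) \<otimes> \<zero>" "r [^] n = \<zero> \<otimes> r [^] (n + 1)"
      using n r by simp_all
    then show ?thesis using n(1) by blast
  qed
qed

text \<open>Iterating the two one-sided equations gives \<open>s = s s X\<close> and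
  \<open>s = Y s s\<close> for \<open>s = r [^] n\<close>, where \<open>X = x [^] n\<close> and
  \<open>Y = y [^] n\<close>. Combining them yields \<open>s = s Y s\<close>, with the same exponent
  \<open>n\<close>.\<close>

lemma (in ring) strongly_pi_regular_imp_pi_regular:
  assumes "strongly_pi_regular R"
  shows "pi_regular R"
  unfolding pi_regular_def
proof
  fix r assume r: "r \<in> carrier R"
  then obtain n :: nat and x y where n: "n > 0" and x: "x \<in> carrier R" and y: "y \<in> carrier R"
    and rx: "r [^] n = r [^] (n + 1) \<otimes> x" and ry: "r [^] n = y \<otimes> r [^] (n + 1)"
    using assms unfolding strongly_pi_regular_def by blast
  \<comment> \<open>\<open>x\<close> and \<open>r\<close> may not commute, so \<open>r [^] m\<close>
    is split off on the left. The new factor \<open>x\<close> then lands directly before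
    \<open>x [^] m\<close>. In \<open>left\<close> the sides are exchanged.\<close>
  have right: "r [^] n = r [^] (n + m) \<otimes> x [^] m" for m :: nat
  proof (induction m)
    case (Suc m)
    have "r [^] (n + m) = r [^] m \<otimes> r [^] n"
      using r by (simp add: nat_pow_mult add.commute)
    also have "\<dots> = r [^] m \<otimes> r [^] (n + 1) \<otimes> x"
      using r x by (subst rx) (simp only: m_assoc nat_pow_closed)
    also have "r [^] m \<otimes> r [^] (n + 1) = r [^] (n + Suc m)"
      by (subst nat_pow_mult[OF r]) (simp add: add.commute)
    finally have "r [^] n = r [^] (n + Suc m) \<otimes> x \<otimes> x [^] m"
      using Suc.IH by simp
    also have "\<dots> = r [^] (n + Suc m) \<otimes> x [^] Suc m"
      using r x by (simp only: m_assoc nat_pow_closed nat_pow_Suc2)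
    finally show ?case .
  qed (use r in simp)
  have left: "r [^] n = y [^] m \<otimes> r [^] (n + m)" for m :: nat
  proof (induction m)
    case (Suc m)
    have "r [^] (n + m) = r [^] n \<otimes> r [^] m"
      using r by (simp add: nat_pow_mult)
    also have "\<dots> = y \<otimes> (r [^] (n + 1) \<otimes> r [^] m)"
      using r y by (subst ry) (simp only: m_assoc nat_pow_closed)
    also have "r [^] (n + 1) \<otimes> r [^] m = r [^] (n + Suc m)"
      by (subst nat_pow_mult[OF r]) simp
    finally have "r [^] n = y [^] m \<otimes> (y \<otimes> r [^] (n + Suc m))"
      using Suc.IH by simp
    also have "\<dots> = y [^] Suc m \<otimes> r [^] (n + Suc m)"
      using r y by (simp only: m_assoc nat_pow_closed nat_pow_Suc)
    finally show ?case .
  qed (use r in simp)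
  let ?s = "r [^] n"
  have s: "?s \<in> carrier R" using r by simp
  have ss: "r [^] (n + n) = ?s \<otimes> ?s" using r by (simp add: nat_pow_mult)
  \<comment> \<open>The chain uses \<open>right\<close>, then \<open>left\<close> on the inner
    \<open>?s\<close>, and after regrouping collapses \<open>?s ?s x [^] n\<close> by
    \<open>right\<close> again.\<close>
  have "?s = ?s \<otimes> (?s \<otimes> x [^] n)"
    using right[of n] s x ss by (simp add: m_assoc)
  also have "\<dots> = ?s \<otimes> (y [^] n \<otimes> (?s \<otimes> ?s) \<otimes> x [^] n)"
    using left[of n] ss by simp
  also have "\<dots> = ?s \<otimes> y [^] n \<otimes> (?s \<otimes> ?s \<otimes> x [^] n)"
    using s x y by (simp add: m_assoc)
  also have "\<dots> = ?s \<otimes> y [^] n \<otimes> ?s"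
    using right[of n] ss by simp
  finally show "\<exists>n::nat. n > 0 \<and> r [^] n \<in> {r [^] n \<otimes> x \<otimes> r [^] n | x. x \<in> carrier R}"
    using n y by blast
qed

text \<open>The trivial idempotents suffice. For a unit take \<open>e = \<one>\<close>, which is
  \<open>a x a\<close> with \<open>x\<close> the square of \<open>inv a\<close> and makes
  \<open>a (1 - e)\<close> zero. For a nilpotent element take \<open>e = \<zero>\<close>, which
  leaves \<open>a (1 - e) = a\<close>.\<close>

lemma (in ring) unit_or_nilpotent_imp_D_regularly_nil_clean:
  assumes "\<And>r. r \<in> carrier R \<Longrightarrow> r \<in> Units R \<or> nilpotent_elem R r"
  shows "D_regularly_nil_clean R"
  unfolding D_regularly_nil_clean_def
proof
  fix a assume a: "a \<in> carrier R"
  from assms[OF a] show "\<exists>e\<in>{a \<otimes> x \<otimes> a | x. x \<in> carrier R}.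
        idempotent_elem R e \<and> nilpotent_elem R (a \<otimes> (\<one> \<ominus> e))"
  proof
    assume u: "a \<in> Units R"
    have "\<one> = a \<otimes> (inv a \<otimes> inv a) \<otimes> a"
      using u a by (simp add: m_assoc)
    moreover have "idempotent_elem R \<one>"
      by (simp add: idempotent_elem_def)
    moreover have "nilpotent_elem R (a \<otimes> (\<one> \<ominus> \<one>))"
      using a by (auto simp: nilpotent_elem_def a_minus_def r_neg intro!: exI[of _ "1::nat"])
    moreover have "inv a \<otimes> inv a \<in> carrier R" using u by simp
    ultimately show ?thesis by blast
  next
    assume nil: "nilpotent_elem R a"
    have "\<zero> = a \<otimes> \<zero> \<otimes> a" using a by simp
    moreover have "idempotent_elem R \<zero>" by (simp add: idempotent_elem_def)
    moreover have "nilpotent_elem R (a \<otimes> (\<one> \<ominus> \<zero>))"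
      using a nil by (simp add: a_minus_def)
    ultimately show ?thesis by blast
  qed
qed

text \<open>Every positive power of an idempotent is the idempotent itself, while by commutativity a
  suitable power of \<open>a \<otimes> x\<close> contains the factor
  \<open>a [^] n = \<zero>\<close>.\<close>

lemma (in cring) idempotent_multiple_of_nilpotent_eq_zero:
  assumes a: "nilpotent_elem R a" and x: "x \<in> carrier R"
    and e: "idempotent_elem R (a \<otimes> x)"
  shows "a \<otimes> x = \<zero>"
proof -
  obtain n :: nat where n: "n > 0" "a [^] n = \<zero>" and ac: "a \<in> carrier R"
    using a by (auto simp: nilpotent_elem_def)
  have "(a \<otimes> x) [^] Suc m = a \<otimes> x" for m :: nat
    using e by (induction m) (auto simp: idempotent_elem_def)
  then have "a \<otimes> x = (a \<otimes> x) [^] n" using n(1) by (metis gr0_implies_Suc)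
  also have "\<dots> = \<zero>" using n(2) ac x by (simp add: nat_pow_distrib)
  finally show ?thesis .
qed

section \<open>Direct products of rings\<close>

lemma product_ring_nat_pow:
  "x [^]\<^bsub>product_ring I R\<^esub> (n::nat) = (\<lambda>i\<in>I. x i [^]\<^bsub>R i\<^esub> n)"
proof (induction n)
  case 0
  show ?case by (simp add: product_ring_def nat_pow_def)
next
  case (Suc n)
  have "x [^]\<^bsub>product_ring I R\<^esub> Suc n =
      (\<lambda>i\<in>I. (x [^]\<^bsub>product_ring I R\<^esub> n) i \<otimes>\<^bsub>R i\<^esub> x i)"
    by (simp add: product_ring_def nat_pow_def)
  with Suc show ?case by (auto simp: nat_pow_def cong: restrict_cong)
qed

lemma ring_product_ring:
  assumes "\<And>i. i \<in> I \<Longrightarrow> ring (R i)"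
  shows "ring (product_ring I R)"
proof (rule ringI)
  show "abelian_group (product_ring I R)"
  proof (rule abelian_groupI)
    fix x assume x: "x \<in> carrier (product_ring I R)"
    let ?y = "\<lambda>i\<in>I. \<ominus>\<^bsub>R i\<^esub> x i"
    have "?y \<in> carrier (product_ring I R)"
      using x assms by (auto simp: product_ring_def intro!: abelian_group.a_inv_closed
          dest: ring.is_abelian_group)
    moreover have "?y \<oplus>\<^bsub>product_ring I R\<^esub> x = \<zero>\<^bsub>product_ring I R\<^esub>"
      using x assms by (auto simp: product_ring_def fun_eq_iff PiE_iff
          intro!: abelian_group.l_neg dest: ring.is_abelian_group)
    ultimately show "\<exists>y\<in>carrier (product_ring I R).
        y \<oplus>\<^bsub>product_ring I R\<^esub> x = \<zero>\<^bsub>product_ring I R\<^esub>" by blast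
  qed (use assms in \<open>auto simp: product_ring_def fun_eq_iff PiE_iff extensional_def
      ring.ring_simprules\<close>)
  show "Group.monoid (product_ring I R)"
    by (rule Group.monoidI) (use assms in \<open>auto simp: product_ring_def fun_eq_iff PiE_iff
      extensional_def ring.ring_simprules ring.is_monoid monoid.m_assoc\<close>)
qed (use assms in \<open>auto simp: product_ring_def fun_eq_iff PiE_iff ring.ring_simprules\<close>)

text \<open>This is the obstruction: the exponents in \<open>nil\<close> may vary with
  \<open>i\<close>, but the conclusion supplies one exponent for all components. The idempotent
  \<open>a x a\<close> vanishes in every component, so the nilpotent element
  \<open>a (1 - e)\<close> is \<open>a\<close> itself.\<close>

lemma nilpotent_if_D_regularly_nil_clean_product:
  assumes R: "\<And>i. i \<in> I \<Longrightarrow> cring (R i)"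
    and clean: "D_regularly_nil_clean (product_ring I R)"
    and a: "a \<in> carrier (product_ring I R)"
    and nil: "\<And>i. i \<in> I \<Longrightarrow> nilpotent_elem (R i) (a i)"
  shows "nilpotent_elem (product_ring I R) a"
proof -
  let ?P = "product_ring I R"
  interpret P: ring ?P
    using R by (intro ring_product_ring) (auto dest: cring.axioms)
  obtain x where x: "x \<in> carrier ?P" and e: "idempotent_elem ?P (a \<otimes>\<^bsub>?P\<^esub> x \<otimes>\<^bsub>?P\<^esub> a)"
    and n: "nilpotent_elem ?P (a \<otimes>\<^bsub>?P\<^esub> (\<one>\<^bsub>?P\<^esub> \<ominus>\<^bsub>?P\<^esub> (a \<otimes>\<^bsub>?P\<^esub> x \<otimes>\<^bsub>?P\<^esub> a)))"
    using clean a unfolding D_regularly_nil_clean_def by blast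
  have "(a \<otimes>\<^bsub>?P\<^esub> x \<otimes>\<^bsub>?P\<^esub> a) i = \<zero>\<^bsub>R i\<^esub>" if i: "i \<in> I" for i
  proof -
    interpret cring "R i" by (rule R[OF i])
    have ai: "a i \<in> carrier (R i)" and xi: "x i \<in> carrier (R i)"
      using a x i by (auto simp: product_ring_def)
    have "(a \<otimes>\<^bsub>?P\<^esub> x \<otimes>\<^bsub>?P\<^esub> a) i = a i \<otimes>\<^bsub>R i\<^esub> (x i \<otimes>\<^bsub>R i\<^esub> a i)"
      using i ai xi by (simp add: product_ring_def m_assoc)
    moreover have "idempotent_elem (R i) ((a \<otimes>\<^bsub>?P\<^esub> x \<otimes>\<^bsub>?P\<^esub> a) i)"
    proof -
      let ?e = "a \<otimes>\<^bsub>?P\<^esub> x \<otimes>\<^bsub>?P\<^esub> a"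
      have "(?e \<otimes>\<^bsub>?P\<^esub> ?e) i = ?e i" "?e \<in> carrier ?P"
        using e by (simp_all add: idempotent_elem_def)
      moreover have "(f \<otimes>\<^bsub>?P\<^esub> f) i = f i \<otimes>\<^bsub>R i\<^esub> f i" for f
        using i by (simp add: product_ring_def)
      moreover have "f i \<in> carrier (R i)" if "f \<in> carrier ?P" for f
        using i that by (auto simp: product_ring_def)
      ultimately show ?thesis by (simp add: idempotent_elem_def)
    qed
    ultimately show ?thesis
      using idempotent_multiple_of_nilpotent_eq_zero[OF nil[OF i]] ai xi by simp
  qed
  \<comment> \<open>Vanishing on \<open>I\<close> gives equality with the zero of the product
    because both functions are extensional.\<close>
  moreover have "a \<otimes>\<^bsub>?P\<^esub> x \<otimes>\<^bsub>?P\<^esub> a \<in> extensional I"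
    by (simp add: product_ring_def)
  ultimately have "a \<otimes>\<^bsub>?P\<^esub> x \<otimes>\<^bsub>?P\<^esub> a = \<zero>\<^bsub>?P\<^esub>"
    by (intro extensionalityI[of _ I]) (auto simp: product_ring_def)
  with n a show ?thesis by (simp add: a_minus_def)
qed

section \<open>The rings of residues modulo powers of two\<close>

lemma residues_power_of_two: "k \<ge> 1 \<Longrightarrow> residues (2 ^ k)"
  by (simp add: residues_def)

text \<open>The exponent \<open>k\<close> itself works: if 2 divides \<open>r\<close>, then
  \<open>2 ^ k\<close> divides \<open>r ^ k\<close>.\<close>

lemma nilpotent_residue_power_of_two:
  assumes k: "k \<ge> 1" and r: "r \<in> carrier (residue_ring (2 ^ k))" and "even r"
  shows "nilpotent_elem (residue_ring (2 ^ k)) r"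
proof -
  interpret residues "2 ^ k" "residue_ring (2 ^ k)" by (rule residues_power_of_two[OF k])
  have "r ^ k mod 2 ^ k = 0" using \<open>even r\<close> by (simp add: dvd_power_same)
  moreover have "r [^]\<^bsub>residue_ring (2 ^ k)\<^esub> k = r ^ k mod 2 ^ k"
    using pow_cong[of r k] r by (simp add: res_carrier_eq)
  ultimately have "r [^]\<^bsub>residue_ring (2 ^ k)\<^esub> k = \<zero>\<^bsub>residue_ring (2 ^ k)\<^esub>"
    by (simp add: res_zero_eq)
  then show ?thesis using k r by (auto simp: nilpotent_elem_def intro!: exI[of _ k])
qed

lemma unit_or_nilpotent_residue_power_of_two:
  assumes k: "k \<ge> 1" and r: "r \<in> carrier (residue_ring (2 ^ k))"
  shows "r \<in> Units (residue_ring (2 ^ k)) \<or> nilpotent_elem (residue_ring (2 ^ k)) r"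
proof (cases "even r")
  case False
  interpret residues "2 ^ k" "residue_ring (2 ^ k)" by (rule residues_power_of_two[OF k])
  \<comment> \<open>Units are described by \<open>res_units_eq\<close> as the positive residues
    coprime to the modulus; oddness excludes \<open>r = 0\<close>.\<close>
  have "0 < r" "r < 2 ^ k" using r False by (auto simp: res_carrier_eq intro: le_neq_trans)
  then have "r \<in> Units (residue_ring (2 ^ k))"
    using False by (simp add: res_units_eq coprime_right_2_iff_odd)
  then show ?thesis ..
qed (use nilpotent_residue_power_of_two[OF k r] in simp)

lemma product_residue_power_of_two_not_D_regularly_nil_clean:
  "\<not> D_regularly_nil_clean (product_ring {k::nat. k \<ge> 1} (\<lambda>k. residue_ring (2 ^ k)))"
    (is "\<not> D_regularly_nil_clean ?P")
proof
  assume clean: "D_regularly_nil_clean ?P"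
  \<comment> \<open>The reduction matters at \<open>k = 1\<close>, where 2 is not a canonical
    representative and the component is 0.\<close>
  define a :: "nat \<Rightarrow> int" where "a = (\<lambda>k\<in>{k. k \<ge> 1}. 2 mod 2 ^ k)"
  have mem: "a k \<in> carrier (residue_ring (2 ^ k))" if "k \<ge> 1" for k
    using that by (simp add: a_def residue_ring_def)
  have "even (a k)" if "k \<ge> 1" for k
    using that by (simp add: a_def dvd_mod_iff)
  then have "nilpotent_elem ?P a"
    using mem clean
    by (intro nilpotent_if_D_regularly_nil_clean_product nilpotent_residue_power_of_two)
      (auto simp: product_ring_def a_def simp del: One_nat_def
        intro: residues.cring residues_power_of_two)
  then obtain n :: nat where "a [^]\<^bsub>?P\<^esub> n = \<zero>\<^bsub>?P\<^esub>"
    by (auto simp: nilpotent_elem_def)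
  \<comment> \<open>The index \<open>n + 1\<close> is the least at which the exponent
    \<open>n\<close> fails: \<open>2 ^ n\<close> is nonzero modulo
    \<open>2 ^ (n + 1)\<close>.\<close>
  then have "(a [^]\<^bsub>?P\<^esub> n) (n + 1) = \<zero>\<^bsub>?P\<^esub> (n + 1)" by simp
  then have "a (n + 1) [^]\<^bsub>residue_ring (2 ^ (n + 1))\<^esub> n = 0"
    unfolding product_ring_nat_pow by (simp add: product_ring_def residue_ring_def)
  moreover
  interpret residues "2 ^ (n + 1)" "residue_ring (2 ^ (n + 1))"
    by (rule residues_power_of_two) simp
  have "a (n + 1) [^]\<^bsub>residue_ring (2 ^ (n + 1))\<^esub> n = 2 ^ n mod 2 ^ (n + 1)"
    using pow_cong[of 2 n] by (simp add: a_def)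
  ultimately show False by simp
qed

theorem mainTheorem9:
  shows
    "(\<exists>(I :: nat set) (S :: nat \<Rightarrow> int ring).
        infinite I \<and> (\<forall>i\<in>I. ring (S i) \<and> strongly_pi_regular (S i)) \<and>
        ring (product_ring I S) \<and> \<not> D_regularly_nil_clean (product_ring I S)) \<and>
     (\<exists>(I :: nat set) (S :: nat \<Rightarrow> int ring).
        infinite I \<and> (\<forall>i\<in>I. ring (S i) \<and> pi_regular (S i)) \<and>
        ring (product_ring I S) \<and> \<not> D_regularly_nil_clean (product_ring I S)) \<and>
     (\<exists>(I :: nat set) (S :: nat \<Rightarrow> int ring).
        infinite I \<and> (\<forall>i\<in>I. ring (S i) \<and> D_regularly_nil_clean (S i)) \<and>
        ring (product_ring I S) \<and> \<not> D_regularly_nil_clean (product_ring I S)) \<and>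
     (\<forall>k::nat. k \<ge> 1 \<longrightarrow>
        ring (residue_ring (2 ^ k)) \<and>
        strongly_pi_regular (residue_ring (2 ^ k)) \<and>
        D_regularly_nil_clean (residue_ring (2 ^ k))) \<and>
     ring (product_ring {k::nat. k \<ge> 1} (\<lambda>k. residue_ring (2 ^ k))) \<and>
     \<not> D_regularly_nil_clean (product_ring {k::nat. k \<ge> 1} (\<lambda>k. residue_ring (2 ^ k)))"
proof -
  let ?I = "{k::nat. k \<ge> 1}" and ?S = "\<lambda>k::nat. residue_ring (2 ^ k)"
  have inf: "infinite ?I"
    using infinite_Ici[of "1::nat"] by (simp only: atLeast_def not_False_eq_True)
  have ring: "ring (?S k)" if "k \<ge> 1" for k
    using residues.cring[OF residues_power_of_two[OF that]] by (rule cring.axioms)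
  have strong: "strongly_pi_regular (?S k)" if "k \<ge> 1" for k
    using that by (intro ring.unit_or_nilpotent_imp_strongly_pi_regular ring
        unit_or_nilpotent_residue_power_of_two)
  have pi: "pi_regular (?S k)" if "k \<ge> 1" for k
    using that by (intro ring.strongly_pi_regular_imp_pi_regular ring strong)
  have clean: "D_regularly_nil_clean (?S k)" if "k \<ge> 1" for k
    using that by (intro ring.unit_or_nilpotent_imp_D_regularly_nil_clean ring
        unit_or_nilpotent_residue_power_of_two)
  have prod: "ring (product_ring ?I ?S)"
    using ring by (intro ring_product_ring) simp
  note not_clean = product_residue_power_of_two_not_D_regularly_nil_clean
  \<comment> \<open>All three existential claims take the same index set \<open>?I\<close> and
    family \<open>?S\<close>; only the property of the factors changes.\<close>
  show ?thesis
    apply (intro conjI allI impI)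
    subgoal using inf ring strong prod not_clean by (intro exI[of _ ?I] exI[of _ ?S]) simp
    subgoal using inf ring pi prod not_clean by (intro exI[of _ ?I] exI[of _ ?S]) simp
    subgoal using inf ring clean prod not_clean by (intro exI[of _ ?I] exI[of _ ?S]) simp
    using ring strong clean prod not_clean by blast+
qed

end
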